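(* Let $\mu=(\mu_1,\dots,\mu_m)$ and $\lambda=(\lambda_1,\dots,\lambda_n)$ be probability vectors, let $\omega_1,\omega_2$ be two weight functions with respect to $\mu$ and $\lambda$, and let $B=[b_{ij}]_{n\times n}$ and $C=[c_{ij}]_{n\times n}$ be two double stochastic matrices. If $x_j\in(0,1/2]$ $(j=1,\dots,n)$, and $A_n=\sum_{j=1}^n\lambda_jx_j$ and $G_n=\prod_{j=1}^nx_j^{\lambda_j}$ (also, $A'_n=\sum_{j=1}^n\lambda_j(1-x_j)$ and $G'_n=\prod_{j=1}^n(1-x_j)^{\lambda_j}$) are the arithmetic and geometric means of $x_1,\dots,x_n$ (of $1-x_1,\dots,1-x_n$) respectively, then the following refinement of Ky Fan's inequality $\frac{A'_n}{A_n}\le\frac{G'_n}{G_n}$ holds: $$\frac{A'_n}{A_n}\le\prod_{i=1}^m\left(\frac{I\left(\sum_{j=1}^n\omega_1(i,j)\lambda_j(1-x_j),\ \sum_{j=1}^n\omega_2(i,j)\lambda_j(1-x_j)\right)}{I\left(\sum_{j=1}^n\omega_1(i,j)\lambda_jx_j,\ \sum_{j=1}^n\omega_2(i,j)\lambda_jx_j\right)}\right)^{\mu_i}\le\frac{G'_n}{G_n},$$ where $I$ is the identric mean. In particular, $$\frac{A'_n}{A_n}\le\sqrt[n]{\prod_{i=1}^n\left(\frac{I\left(\sum_{j=1}^nb_{ij}(1-x_j),\ \sum_{j=1}^nc_{ij}(1-x_j)\right)}{I\left(\sum_{j=1}^nb_{ij}x_j,\ \sum_{j=1}^nc_{ij}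x_j\right)}\right)}\le\frac{G'_n}{G_n}.$$
   Context: $m,n\ge1$ are integers. Probability vectors: $\mu_i\ge0$, $\lambda_j\ge0$, $\sum_{i=1}^m\mu_i=1$, $\sum_{j=1}^n\lambda_j=1$. A weight function with respect to $\mu$ and $\lambda$ is a map $\omega:\{1,\dots,m\}\times\{1,\dots,n\}\to[0,\infty)$ such that $\sum_{i=1}^m\omega(i,j)\mu_i=1$ for every $j=1,\dots,n$ and $\sum_{j=1}^n\omega(i,j)\lambda_j=1$ for every $i=1,\dots,m$. A double stochastic matrix is a square matrix with nonnegative real entries each of whose rows and columns sums to $1$. The identric mean of $a,b>0$ is $I(a,b)=a$ if $a=b$, and $I(a,b)=\frac1e\left(\frac{b^b}{a^a}\right)^{1/(b-a)}$ if $a\ne b$.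
   Formalization: In the final "in particular" display, the means A_n, G_n, A'_n, G'_n are taken with equal weights 1/n instead of the general λ; for non-uniform λ that display fails, e.g. n=2, λ=(1,0), B=C=identity, x=(1/2,1/4). *)

theory Defs
  imports Complex_Main
begin

text \<open>
  Vectors of length \<open>n\<close> are functions on \<open>nat\<close>, and \<open>m \<times> n\<close> matrices are binary functions on
  \<open>nat\<close>; only the values at the indices \<open>{1..n}\<close> and \<open>{1..m}\<close> matter.
\<close>

definition probability_vector :: "nat \<Rightarrow> (nat \<Rightarrow> real) \<Rightarrow> bool" where
  "probability_vector n p \<longleftrightarrow> (\<forall>i\<in>{1..n}. 0 \<le> p i) \<and> (\<Sum>i=1..n. p i) = 1"

definition weight_function ::
    "nat \<Rightarrow> nat \<Rightarrow> (nat \<Rightarrow> real) \<Rightarrow> (nat \<Rightarrow> real) \<Rightarrow> (nat \<Rightarrow> nat \<Rightarrow> real) \<Rightarrow> bool" where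
  "weight_function m n \<mu> lam \<omega> \<longleftrightarrow>
     (\<forall>i\<in>{1..m}. \<forall>j\<in>{1..n}. 0 \<le> \<omega> i j) \<and>
     (\<forall>j\<in>{1..n}. (\<Sum>i=1..m. \<omega> i j * \<mu> i) = 1) \<and>
     (\<forall>i\<in>{1..m}. (\<Sum>j=1..n. \<omega> i j * lam j) = 1)"

definition double_stochastic :: "nat \<Rightarrow> (nat \<Rightarrow> nat \<Rightarrow> real) \<Rightarrow> bool" where
  "double_stochastic n B \<longleftrightarrow>
     (\<forall>i\<in>{1..n}. \<forall>j\<in>{1..n}. 0 \<le> B i j) \<and>
     (\<forall>i\<in>{1..n}. (\<Sum>j=1..n. B i j) = 1) \<and>
     (\<forall>j\<in>{1..n}. (\<Sum>i=1..n. B i j) = 1)"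

definition arithmetic_mean :: "nat \<Rightarrow> (nat \<Rightarrow> real) \<Rightarrow> (nat \<Rightarrow> real) \<Rightarrow> real" where
  "arithmetic_mean n lam x = (\<Sum>j=1..n. lam j * x j)"

definition geometric_mean :: "nat \<Rightarrow> (nat \<Rightarrow> real) \<Rightarrow> (nat \<Rightarrow> real) \<Rightarrow> real" where
  "geometric_mean n lam x = (\<Prod>j=1..n. x j powr lam j)"

text \<open>Only meaningful for positive \<open>a\<close> and \<open>b\<close>.\<close>

definition identric_mean :: "real \<Rightarrow> real \<Rightarrow> real" where
  "identric_mean a b =
     (if a = b then a
      else 1 / exp 1 * ((b powr b) / (a powr a)) powr (1 / (b - a)))"

end

theory Submission
  imports Defs "HOL-Analysis.Convex"
begin

text \<open>
  Put \<open>f t = ln ((1 - t) / t)\<close>, which is convex on \<open>(0, 1/2]\<close>. With \<open>A = (\<Sum>j. \<lambda>\<^sub>j x\<^sub>j)\<close>, the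
  logarithms of the outer terms are \<open>f A\<close> and \<open>(\<Sum>j. \<lambda>\<^sub>j f x\<^sub>j)\<close>, so Ky Fan's inequality is Jensen's
  inequality for \<open>f\<close>. A single weight function \<open>\<omega>\<close> refines it: with \<open>c\<^sub>i = (\<Sum>j. \<omega>(i,j) \<lambda>\<^sub>j x\<^sub>j)\<close>
  one has \<open>f A \<le> (\<Sum>i. \<mu>\<^sub>i f c\<^sub>i) \<le> (\<Sum>j. \<lambda>\<^sub>j f x\<^sub>j)\<close>, by Jensen's inequality over \<open>i\<close> on the left
  and, for each \<open>i\<close>, over \<open>j\<close> on the right (lemma \<open>weight_function_Jensen\<close>).

  The identric mean enters because \<open>ln (I(a,b))\<close> is the average of \<open>ln\<close> over the interval between
  \<open>a\<close> and \<open>b\<close>. Hence \<open>ln (I(1-a,1-b) / I(a,b))\<close> is the average of \<open>f ((1-s) a + s b)\<close> over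
  \<open>s\<close> in \<open>[0,1]\<close>. With \<open>a\<^sub>i\<close> and \<open>b\<^sub>i\<close> the row means belonging to \<open>\<omega>\<^sub>1\<close> and \<open>\<omega>\<^sub>2\<close>, the logarithm of
  the middle term is therefore the average of \<open>(\<Sum>i. \<mu>\<^sub>i f ((1-s) a\<^sub>i + s b\<^sub>i))\<close> over \<open>s\<close>. Rather than
  integrating, the mean value theorem replaces this average by the value at one \<open>s\<close> common to
  all \<open>i\<close> (lemma \<open>sum_ln_identric_mean_ratio\<close>). For this \<open>s\<close> the points \<open>(1-s) a\<^sub>i + s b\<^sub>i\<close> are the
  row means of the weight function \<open>(1-s) \<omega>\<^sub>1 + s \<omega>\<^sub>2\<close>, and the refinement for a single weight
  function applies.

  A double stochastic matrix times \<open>n\<close> is a weight function for uniform \<open>\<mu>\<close> and \<open>\<lambda>\<close>, which gives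
  the statement about matrices.
\<close>

section \<open>Log-odds and the identric mean\<close>

definition log_odds_against :: "real \<Rightarrow> real" where
  "log_odds_against t = ln (1 - t) - ln t"

lemma log_odds_against_has_derivative:
  assumes "0 < t" "t < 1"
  shows "(log_odds_against has_real_derivative (- 1 / (1 - t) - 1 / t)) (at t)"
  unfolding log_odds_against_def [abs_def] using assms
  by (auto intro!: derivative_eq_intros)

text \<open>The second derivative \<open>1 / t\<^sup>2 - 1 / (1 - t)\<^sup>2\<close> changes sign at \<open>1/2\<close>; this is where the
restriction of the \<open>x\<^sub>j\<close> to \<open>(0, 1/2]\<close> is needed.\<close>

lemma convex_on_log_odds_against: "convex_on {0<..1/2} log_odds_against"
proof (rule f''_ge0_imp_convex)
  show "convex {0<..1/2::real}" by simp
  show "(log_odds_against has_real_derivative (- 1 / (1 - t) - 1 / t)) (at t)" if "t \<in> {0<..1/2}" for t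
    using that by (intro log_odds_against_has_derivative) auto
  show "((\<lambda>t. - 1 / (1 - t) - 1 / t) has_real_derivative (1 / t\<^sup>2 - 1 / (1 - t)\<^sup>2)) (at t)"
    if "t \<in> {0<..1/2}" for t :: real
    using that by (auto intro!: derivative_eq_intros simp: power2_eq_square)
  show "1 / t\<^sup>2 - 1 / (1 - t)\<^sup>2 \<ge> 0" if "t \<in> {0<..1/2}" for t :: real
    using that by (auto intro!: frac_le power_mono)
qed

lemma identric_mean_pos:
  assumes "0 < a" "0 < b"
  shows "0 < identric_mean a b"
  using assms by (simp add: identric_mean_def)

lemma ln_identric_mean:
  assumes "0 < a" "0 < b" "a \<noteq> b"
  shows "ln (identric_mean a b) = (b * ln b - a * ln a) / (b - a) - 1"
  using assms by (simp add: identric_mean_def ln_mult ln_div ln_powr)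

text \<open>For \<open>a \<noteq> b\<close> the right-hand side is the difference quotient of the binary entropy, a primitive
of \<^const>\<open>log_odds_against\<close>, so it is the average of \<^const>\<open>log_odds_against\<close> between \<open>a\<close> and \<open>b\<close>.\<close>

lemma ln_identric_mean_ratio:
  assumes "0 < a" "a < 1" "0 < b" "b < 1"
  shows "ln (identric_mean (1 - a) (1 - b) / identric_mean a b) =
    (if a = b then log_odds_against a
     else (- b * ln b - (1 - b) * ln (1 - b) + a * ln a + (1 - a) * ln (1 - a)) / (b - a))"
proof (cases "a = b")
  case True
  then show ?thesis using assms by (simp add: identric_mean_def log_odds_against_def ln_div)
next
  case False
  have flip: "p / (a - b) = - p / (b - a)" for p
    by (metis minus_diff_eq minus_divide_divide minus_minus)
  have "ln (identric_mean (1 - a) (1 - b) / identric_mean a b)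
      = ln (identric_mean (1 - a) (1 - b)) - ln (identric_mean a b)"
    using assms identric_mean_pos[of a b] identric_mean_pos[of "1-a" "1-b"] by (simp add: ln_div)
  also have "\<dots> = ((1 - b) * ln (1 - b) - (1 - a) * ln (1 - a)) / (a - b)
      - (b * ln b - a * ln a) / (b - a)"
    using assms False by (simp add: ln_identric_mean)
  also have "\<dots> = (- b * ln b - (1 - b) * ln (1 - b) + a * ln a + (1 - a) * ln (1 - a)) / (b - a)"
    unfolding flip diff_divide_distrib [symmetric] by (simp add: algebra_simps)
  finally show ?thesis using False by simp
qed

text \<open>Each summand on the left is the increment over \<open>[0,1]\<close> of an explicit function of \<open>s\<close> whose
derivative is the summand on the right. Applying the mean value theorem to the weighted sum of
these functions, instead of to each one, yields the same \<open>s\<close> for all \<open>i\<close>.\<close>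

lemma sum_ln_identric_mean_ratio:
  fixes a b :: "'i \<Rightarrow> real"
  assumes "finite K"
    and ab: "\<And>i. i \<in> K \<Longrightarrow> 0 < a i \<and> a i < 1 \<and> 0 < b i \<and> b i < 1"
  obtains s where "0 < s" "s < 1"
    "(\<Sum>i\<in>K. \<mu> i * ln (identric_mean (1 - a i) (1 - b i) / identric_mean (a i) (b i)))
       = (\<Sum>i\<in>K. \<mu> i * log_odds_against ((1 - s) * a i + s * b i))"
proof -
  \<comment> \<open>the binary entropy\<close>
  define H :: "real \<Rightarrow> real" where "H t = - t * ln t - (1 - t) * ln (1 - t)" for t
  \<comment> \<open>a primitive of \<open>s \<mapsto> log_odds_against ((1 - s) * a i + s * b i)\<close>; if \<open>a i = b i\<close> this
    function is constant\<close>
  define P where "P i s = (if a i = b i then s * log_odds_against (a i)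
      else H ((1 - s) * a i + s * b i) / (b i - a i))" for i s
  have H: "(H has_real_derivative log_odds_against t) (at t)" if "0 < t" "t < 1" for t
    unfolding H_def [abs_def] log_odds_against_def using that
    by (auto intro!: derivative_eq_intros)
  have P: "(P i has_real_derivative log_odds_against ((1 - s) * a i + s * b i)) (at s)"
    if "i \<in> K" "0 \<le> s" "s \<le> 1" for i s
  proof (cases "a i = b i")
    case True
    then have "(1 - s) * a i + s * b i = a i" by (simp add: algebra_simps)
    then show ?thesis using True
      unfolding P_def [abs_def] by (auto intro!: derivative_eq_intros)
  next
    case False
    let ?t = "(1 - s) * a i + s * b i"
    have "?t \<in> {0<..<1}"
      using ab[OF that(1)] that convexD[of "{0<..<1::real}" "a i" "b i" "1 - s" s] by auto
    then have "(H has_real_derivative log_odds_against ?t) (at ?t)" by (intro H) auto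
    moreover have "((\<lambda>s. (1 - s) * a i + s * b i) has_real_derivative b i - a i) (at s)"
      by (auto intro!: derivative_eq_intros)
    ultimately have "((\<lambda>s. H ((1 - s) * a i + s * b i)) has_real_derivative
        log_odds_against ?t * (b i - a i)) (at s)"
      by (rule DERIV_chain2)
    from DERIV_cdivide[OF this, of "b i - a i"] show ?thesis
      using False unfolding P_def [abs_def] by simp
  qed
  have "((\<lambda>s. \<Sum>i\<in>K. \<mu> i * P i s) has_real_derivative
      (\<Sum>i\<in>K. \<mu> i * log_odds_against ((1 - s) * a i + s * b i))) (at s)" if "0 \<le> s" "s \<le> 1" for s
    using that by (intro DERIV_sum DERIV_cmult P)
  then obtain s where s: "0 < s" "s < 1"
    "(\<Sum>i\<in>K. \<mu> i * P i 1) - (\<Sum>i\<in>K. \<mu> i * P i 0)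
       = (1 - 0) * (\<Sum>i\<in>K. \<mu> i * log_odds_against ((1 - s) * a i + s * b i))"
    using MVT2[of 0 1 "\<lambda>s. \<Sum>i\<in>K. \<mu> i * P i s"
        "\<lambda>s. \<Sum>i\<in>K. \<mu> i * log_odds_against ((1 - s) * a i + s * b i)"] by auto
  have "P i 1 - P i 0 = ln (identric_mean (1 - a i) (1 - b i) / identric_mean (a i) (b i))"
    if "i \<in> K" for i
    using ab[OF that] by (simp add: ln_identric_mean_ratio P_def H_def flip: diff_divide_distrib)
  then have "(\<Sum>i\<in>K. \<mu> i * ln (identric_mean (1 - a i) (1 - b i) / identric_mean (a i) (b i)))
      = (\<Sum>i\<in>K. \<mu> i * (P i 1 - P i 0))" by simp
  also have "\<dots> = (\<Sum>i\<in>K. \<mu> i * log_odds_against ((1 - s) * a i + s * b i))"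
    using s(3) by (simp add: sum_subtractf right_diff_distrib)
  finally show ?thesis using s that by blast
qed

section \<open>Refining Jensen's inequality by weight functions\<close>

lemma convex_Jensen_sum:
  fixes f :: "real \<Rightarrow> real"
  assumes "convex_on S f" "\<And>i. i \<in> K \<Longrightarrow> 0 \<le> p i" "(\<Sum>i\<in>K. p i) = 1"
    and "\<And>i. i \<in> K \<Longrightarrow> y i \<in> S"
  shows "(\<Sum>i\<in>K. p i * y i) \<in> S" and "f (\<Sum>i\<in>K. p i * y i) \<le> (\<Sum>i\<in>K. p i * f (y i))"
proof -
  have K: "finite K" "K \<noteq> {}"
    using assms(3) by (auto intro: ccontr)
  show "(\<Sum>i\<in>K. p i * y i) \<in> S"
    using convex_sum[OF K(1) convex_on_imp_convex[OF assms(1)] assms(3,2,4)] by simp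
  show "f (\<Sum>i\<in>K. p i * y i) \<le> (\<Sum>i\<in>K. p i * f (y i))"
    using convex_on_sum[OF K assms(1,3,2,4)] by simp
qed

lemma weighted_row_mem:
  assumes "weight_function m n \<mu> lam \<omega>" "probability_vector n lam" "i \<in> {1..m}"
    and "convex S" and "\<forall>j\<in>{1..n}. x j \<in> S"
  shows "(\<Sum>j=1..n. \<omega> i j * lam j * x j) \<in> S"
  using assms convex_sum[of "{1..n}" S "\<lambda>j. \<omega> i j * lam j" x]
  by (simp add: weight_function_def probability_vector_def)

text \<open>The rows of \<open>\<omega>\<close> turn the points \<open>x\<^sub>j\<close> into averages \<open>c\<^sub>i = (\<Sum>j. \<omega> i j * lam j * x j)\<close>, and the column condition makes the
\<open>\<mu>\<close>-mean of these equal to the \<open>lam\<close>-mean of \<open>x\<close>. Both inequalities are Jensen's: the first for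
the points \<open>c\<^sub>i\<close> with weights \<open>\<mu>\<close>, the second for \<open>x\<close> with the weights in each row.\<close>

lemma weight_function_Jensen:
  assumes w: "weight_function m n \<mu> lam \<omega>"
    and mu: "probability_vector m \<mu>" and lam: "probability_vector n lam"
    and f: "convex_on S f" and x: "\<forall>j\<in>{1..n}. x j \<in> S"
  shows "f (\<Sum>j=1..n. lam j * x j) \<le> (\<Sum>i=1..m. \<mu> i * f (\<Sum>j=1..n. \<omega> i j * lam j * x j))"
    and "(\<Sum>i=1..m. \<mu> i * f (\<Sum>j=1..n. \<omega> i j * lam j * x j)) \<le> (\<Sum>j=1..n. lam j * f (x j))"
proof -
  let ?c = "\<lambda>i. \<Sum>j=1..n. \<omega> i j * lam j * x j"
  \<comment> \<open>used with \<open>y = x\<close> for the first inequality and with \<open>y = f \<circ> x\<close> for the second\<close>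
  have avg: "(\<Sum>i=1..m. \<mu> i * (\<Sum>j=1..n. \<omega> i j * lam j * y j)) = (\<Sum>j=1..n. lam j * y j)" for y
  proof -
    have "(\<Sum>i=1..m. \<mu> i * (\<Sum>j=1..n. \<omega> i j * lam j * y j))
        = (\<Sum>j=1..n. \<Sum>i=1..m. \<mu> i * (\<omega> i j * lam j * y j))"
      unfolding sum_distrib_left by (rule sum.swap)
    also have "\<dots> = (\<Sum>j=1..n. (\<Sum>i=1..m. \<omega> i j * \<mu> i) * (lam j * y j))"
      unfolding sum_distrib_right by (intro sum.cong) auto
    also have "\<dots> = (\<Sum>j=1..n. lam j * y j)"
      using w by (intro sum.cong) (auto simp: weight_function_def)
    finally show ?thesis .
  qed
  have S: "?c i \<in> S" if "i \<in> {1..m}" for i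
    using weighted_row_mem[OF w lam that convex_on_imp_convex[OF f] x] .
  show "f (\<Sum>j=1..n. lam j * x j) \<le> (\<Sum>i=1..m. \<mu> i * f (?c i))"
    using convex_Jensen_sum(2)[OF f, of "{1..m}" \<mu> ?c] mu S
    unfolding avg probability_vector_def by auto
  have "(\<Sum>i=1..m. \<mu> i * f (?c i)) \<le> (\<Sum>i=1..m. \<mu> i * (\<Sum>j=1..n. \<omega> i j * lam j * f (x j)))"
    using mu lam w x
    by (intro sum_mono mult_left_mono convex_Jensen_sum(2)[OF f])
      (auto simp: weight_function_def probability_vector_def)
  then show "(\<Sum>i=1..m. \<mu> i * f (?c i)) \<le> (\<Sum>j=1..n. lam j * f (x j))"
    unfolding avg .
qed

lemma weight_function_convex_combination:
  assumes "weight_function m n \<mu> lam \<omega>\<^sub>1" "weight_function m n \<mu> lam \<omega>\<^sub>2" "0 \<le> s" "s \<le> 1"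
  shows "weight_function m n \<mu> lam (\<lambda>i j. (1 - s) * \<omega>\<^sub>1 i j + s * \<omega>\<^sub>2 i j)"
proof -
  have mix: "(\<Sum>k\<in>K. ((1 - s) * f k + s * g k) * p k) = 1"
    if "(\<Sum>k\<in>K. f k * p k) = 1" "(\<Sum>k\<in>K. g k * p k) = 1" for f g p :: "nat \<Rightarrow> real" and K
  proof -
    have "(\<Sum>k\<in>K. ((1 - s) * f k + s * g k) * p k)
        = (1 - s) * (\<Sum>k\<in>K. f k * p k) + s * (\<Sum>k\<in>K. g k * p k)"
      by (simp add: sum_distrib_left sum.distrib distrib_right mult.assoc)
    then show ?thesis using that by simp
  qed
  show ?thesis
    unfolding weight_function_def
  proof (intro conjI ballI)
    fix j assume "j \<in> {1..n}"
    then show "(\<Sum>i=1..m. ((1 - s) * \<omega>\<^sub>1 i j + s * \<omega>\<^sub>2 i j) * \<mu> i) = 1"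
      using mix[of "\<lambda>i. \<omega>\<^sub>1 i j" \<mu> "{1..m}" "\<lambda>i. \<omega>\<^sub>2 i j"] assms(1,2)
      unfolding weight_function_def by blast
  next
    fix i assume "i \<in> {1..m}"
    then show "(\<Sum>j=1..n. ((1 - s) * \<omega>\<^sub>1 i j + s * \<omega>\<^sub>2 i j) * lam j) = 1"
      using mix[of "\<omega>\<^sub>1 i" lam "{1..n}" "\<omega>\<^sub>2 i"] assms(1,2)
      unfolding weight_function_def by blast
  qed (use assms in \<open>auto simp: weight_function_def\<close>)
qed

section \<open>The refinement of Ky Fan's inequality\<close>

lemma weighted_row_complement:
  assumes "weight_function m n \<mu> lam \<omega>" "i \<in> {1..m}"
  shows "(\<Sum>j=1..n. \<omega> i j * lam j * (1 - x j)) = 1 - (\<Sum>j=1..n. \<omega> i j * lam j * x j)"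
  using assms by (simp add: weight_function_def right_diff_distrib sum_subtractf)

lemma prod_powr_eq_exp:
  fixes p y :: "'i \<Rightarrow> real"
  assumes "finite K" "\<And>i. i \<in> K \<Longrightarrow> 0 < y i"
  shows "(\<Prod>i\<in>K. y i powr p i) = exp (\<Sum>i\<in>K. p i * ln (y i))"
  unfolding exp_sum[OF assms(1)]
proof (rule prod.cong)
  show "y i powr p i = exp (p i * ln (y i))" if "i \<in> K" for i
    using assms(2)[OF that] by (simp add: powr_def)
qed simp

text \<open>The hypotheses keep the weighted arithmetic mean of \<open>x\<close> in \<open>(0, 1/2]\<close>, so that all
logarithms below are of positive numbers. In this form Ky Fan's inequality itself is Jensen's
inequality for the log-odds.\<close>

lemma mean_ratios_eq_exp:
  assumes lam: "probability_vector n lam" and x: "\<forall>j\<in>{1..n}. 0 < x j \<and> x j \<le> 1/2"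
  shows "arithmetic_mean n lam (\<lambda>j. 1 - x j) / arithmetic_mean n lam x
      = exp (log_odds_against (\<Sum>j=1..n. lam j * x j))"
    and "geometric_mean n lam (\<lambda>j. 1 - x j) / geometric_mean n lam x
      = exp (\<Sum>j=1..n. lam j * log_odds_against (x j))"
proof -
  let ?A = "\<Sum>j=1..n. lam j * x j"
  have "?A \<in> {0<..1/2}"
    using convex_Jensen_sum(1)[OF convex_on_log_odds_against, of "{1..n}" lam x] lam x
    by (simp add: probability_vector_def)
  moreover have "arithmetic_mean n lam (\<lambda>j. 1 - x j) = 1 - ?A"
    using lam
    by (simp add: arithmetic_mean_def probability_vector_def right_diff_distrib sum_subtractf)
  ultimately show "arithmetic_mean n lam (\<lambda>j. 1 - x j) / arithmetic_mean n lam x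
      = exp (log_odds_against ?A)"
    by (simp add: arithmetic_mean_def log_odds_against_def exp_diff)
  have gm: "geometric_mean n lam y = exp (\<Sum>j=1..n. lam j * ln (y j))"
    if "\<forall>j\<in>{1..n}. 0 < y j" for y
    unfolding geometric_mean_def using that by (intro prod_powr_eq_exp) auto
  have "\<forall>j\<in>{1..n}. 0 < 1 - x j" using x by force
  then show "geometric_mean n lam (\<lambda>j. 1 - x j) / geometric_mean n lam x
      = exp (\<Sum>j=1..n. lam j * log_odds_against (x j))"
    using x by (simp add: gm log_odds_against_def right_diff_distrib sum_subtractf exp_diff)
qed

text \<open>Positivity of the factors is part of the conclusion because passing from their powers to the \<open>n\<close>-th root of
their product uses it.\<close>

lemma Ky_Fan_refinement:
  assumes mu: "probability_vector m \<mu>" and lam: "probability_vector n lam"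
    and w1: "weight_function m n \<mu> lam \<omega>\<^sub>1" and w2: "weight_function m n \<mu> lam \<omega>\<^sub>2"
    and x: "\<forall>j\<in>{1..n}. 0 < x j \<and> x j \<le> 1/2"
  defines "R \<equiv> \<lambda>i. identric_mean (\<Sum>j=1..n. \<omega>\<^sub>1 i j * lam j * (1 - x j))
                                  (\<Sum>j=1..n. \<omega>\<^sub>2 i j * lam j * (1 - x j))
                / identric_mean (\<Sum>j=1..n. \<omega>\<^sub>1 i j * lam j * x j)
                                (\<Sum>j=1..n. \<omega>\<^sub>2 i j * lam j * x j)"
  shows "\<forall>i\<in>{1..m}. 0 < R i"
    and "arithmetic_mean n lam (\<lambda>j. 1 - x j) / arithmetic_mean n lam x \<le> (\<Prod>i=1..m. R i powr \<mu> i)"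
    and "(\<Prod>i=1..m. R i powr \<mu> i) \<le> geometric_mean n lam (\<lambda>j. 1 - x j) / geometric_mean n lam x"
proof -
  define a where "a i = (\<Sum>j=1..n. \<omega>\<^sub>1 i j * lam j * x j)" for i
  define b where "b i = (\<Sum>j=1..n. \<omega>\<^sub>2 i j * lam j * x j)" for i
  have xS: "\<forall>j\<in>{1..n}. x j \<in> {0<..1/2}" using x by simp
  have S: "convex {0<..1/2::real}" by simp
  have ab: "0 < a i \<and> a i < 1 \<and> 0 < b i \<and> b i < 1" if "i \<in> {1..m}" for i
    using weighted_row_mem[OF w1 lam that S xS] weighted_row_mem[OF w2 lam that S xS]
    by (simp add: a_def b_def)
  have R: "R i = identric_mean (1 - a i) (1 - b i) / identric_mean (a i) (b i)"
    if "i \<in> {1..m}" for i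
    unfolding R_def a_def b_def
    by (simp only: weighted_row_complement[OF w1 that] weighted_row_complement[OF w2 that])
  show pos: "\<forall>i\<in>{1..m}. 0 < R i"
    using ab by (simp add: R identric_mean_pos)
  obtain s where s: "0 < s" "s < 1"
    "(\<Sum>i=1..m. \<mu> i * ln (identric_mean (1 - a i) (1 - b i) / identric_mean (a i) (b i)))
       = (\<Sum>i=1..m. \<mu> i * log_odds_against ((1 - s) * a i + s * b i))"
    using sum_ln_identric_mean_ratio[of "{1..m}" a b \<mu>] ab by blast
  let ?w = "\<lambda>i j. (1 - s) * \<omega>\<^sub>1 i j + s * \<omega>\<^sub>2 i j"
  have w: "weight_function m n \<mu> lam ?w"
    using s w1 w2 by (intro weight_function_convex_combination) auto
  have row: "(\<Sum>j=1..n. ?w i j * lam j * x j) = (1 - s) * a i + s * b i" for i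
    by (simp add: a_def b_def distrib_right sum.distrib sum_distrib_left mult.assoc)
  have "(\<Prod>i=1..m. R i powr \<mu> i) = exp (\<Sum>i=1..m. \<mu> i * ln (R i))"
    using pos by (intro prod_powr_eq_exp) auto
  also have "\<dots> = exp (\<Sum>i=1..m. \<mu> i * log_odds_against (\<Sum>j=1..n. ?w i j * lam j * x j))"
    unfolding row s(3)[symmetric] by (simp add: R)
  finally have prod: "(\<Prod>i=1..m. R i powr \<mu> i) = \<dots>" .
  show "arithmetic_mean n lam (\<lambda>j. 1 - x j) / arithmetic_mean n lam x \<le> (\<Prod>i=1..m. R i powr \<mu> i)"
    unfolding prod mean_ratios_eq_exp(1)[OF lam x] exp_le_cancel_iff
    by (rule weight_function_Jensen(1)[OF w mu lam convex_on_log_odds_against xS])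
  show "(\<Prod>i=1..m. R i powr \<mu> i) \<le> geometric_mean n lam (\<lambda>j. 1 - x j) / geometric_mean n lam x"
    unfolding prod mean_ratios_eq_exp(2)[OF lam x] exp_le_cancel_iff
    by (rule weight_function_Jensen(2)[OF w mu lam convex_on_log_odds_against xS])
qed

lemma probability_vector_uniform:
  assumes "1 \<le> n"
  shows "probability_vector n (\<lambda>_. 1 / real n)"
  using assms by (simp add: probability_vector_def)

lemma double_stochastic_imp_weight_function:
  assumes "1 \<le> n" "double_stochastic n B"
  shows "weight_function n n (\<lambda>_. 1 / real n) (\<lambda>_. 1 / real n) (\<lambda>i j. real n * B i j)"
  using assms by (simp add: double_stochastic_def weight_function_def)

theorem theorem3p2:
  fixes m n :: nat
    and \<mu> lam x :: "nat \<Rightarrow> real"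
    and \<omega>\<^sub>1 \<omega>\<^sub>2 B C :: "nat \<Rightarrow> nat \<Rightarrow> real"
  assumes "1 \<le> m" and "1 \<le> n"
    and "probability_vector m \<mu>" and "probability_vector n lam"
    and "weight_function m n \<mu> lam \<omega>\<^sub>1" and "weight_function m n \<mu> lam \<omega>\<^sub>2"
    and "double_stochastic n B" and "double_stochastic n C"
    and "\<forall>j\<in>{1..n}. 0 < x j \<and> x j \<le> 1/2"
  shows "(arithmetic_mean n lam (\<lambda>j. 1 - x j) / arithmetic_mean n lam x
          \<le> (\<Prod>i=1..m.
               (identric_mean (\<Sum>j=1..n. \<omega>\<^sub>1 i j * lam j * (1 - x j))
                              (\<Sum>j=1..n. \<omega>\<^sub>2 i j * lam j * (1 - x j))
                / identric_mean (\<Sum>j=1..n. \<omega>\<^sub>1 i j * lam j * x j)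
                                (\<Sum>j=1..n. \<omega>\<^sub>2 i j * lam j * x j)) powr \<mu> i)
        \<and> (\<Prod>i=1..m.
               (identric_mean (\<Sum>j=1..n. \<omega>\<^sub>1 i j * lam j * (1 - x j))
                              (\<Sum>j=1..n. \<omega>\<^sub>2 i j * lam j * (1 - x j))
                / identric_mean (\<Sum>j=1..n. \<omega>\<^sub>1 i j * lam j * x j)
                                (\<Sum>j=1..n. \<omega>\<^sub>2 i j * lam j * x j)) powr \<mu> i)
          \<le> geometric_mean n lam (\<lambda>j. 1 - x j) / geometric_mean n lam x)
      \<and> (arithmetic_mean n (\<lambda>_. 1 / real n) (\<lambda>j. 1 - x j)
           / arithmetic_mean n (\<lambda>_. 1 / real n) x
          \<le> root n (\<Prod>i=1..n.
               identric_mean (\<Sum>j=1..n. B i j * (1 - x j)) (\<Sum>j=1..n. C i j * (1 - x j))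
               / identric_mean (\<Sum>j=1..n. B i j * x j) (\<Sum>j=1..n. C i j * x j))
        \<and> root n (\<Prod>i=1..n.
               identric_mean (\<Sum>j=1..n. B i j * (1 - x j)) (\<Sum>j=1..n. C i j * (1 - x j))
               / identric_mean (\<Sum>j=1..n. B i j * x j) (\<Sum>j=1..n. C i j * x j))
          \<le> geometric_mean n (\<lambda>_. 1 / real n) (\<lambda>j. 1 - x j)
             / geometric_mean n (\<lambda>_. 1 / real n) x)"
proof -
  have scale: "real n * c * (1 / real n) * y = c * y" for c y
    using assms(2) by simp
  note uniform = Ky_Fan_refinement[OF
      probability_vector_uniform[OF assms(2)] probability_vector_uniform[OF assms(2)]
      double_stochastic_imp_weight_function[OF assms(2,7)]
      double_stochastic_imp_weight_function[OF assms(2,8)] assms(9), unfolded scale]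
  let ?R = "\<lambda>i. identric_mean (\<Sum>j=1..n. B i j * (1 - x j)) (\<Sum>j=1..n. C i j * (1 - x j))
               / identric_mean (\<Sum>j=1..n. B i j * x j) (\<Sum>j=1..n. C i j * x j)"
  have "root n (\<Prod>i=1..n. ?R i) = (\<Prod>i=1..n. ?R i) powr (1 / real n)"
    using assms(2) uniform(1) by (intro root_powr_inverse prod_nonneg) (auto intro: less_imp_le)
  also have "\<dots> = (\<Prod>i=1..n. ?R i powr (1 / real n))"
    by (rule prod_powr_distrib)
  finally have root: "root n (\<Prod>i=1..n. ?R i) = \<dots>" .
  show ?thesis
    unfolding root
    using Ky_Fan_refinement(2,3)[OF assms(3-6,9)] uniform(2,3) by (intro conjI)
qed

end
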